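(* Let $k\geq 1$ be an odd integer. The least positive residue of the inverse of $d = 2^{4k} + 2^{3k} + 2^{2k} + 2^k - 1$ modulo $2^{5k}-1$ is $$t = \frac{1}{2}\left( \frac{2^{5k}-1}{2^k-1}\cdot\frac{2^{k+1}-1}{3} - 1\right).$$ Furthermore, $$2\cdot t = \left(\sum_{i=0}^{4}\sum_{j=0}^{\frac{k-1}{2}} 2^{ik+2j}\right) - 1,$$ and $\mathrm{wt}(t) = \frac{5k+3}{2}$.
   Context: For a nonnegative integer $v$ with binary representation $v=\sum_{i=0}^{l} v_i 2^i$, $v_i\in\{0,1\}$, the binary weight is $\mathrm{wt}(v)=\sum_{i=0}^l v_i$ (sum in $\mathbb{Z}$). The least positive residue of the inverse of $d$ modulo $M$ is the smallest positive integer $t$ with $d\cdot t\equiv 1 \pmod M$. *)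

theory Defs
  imports Complex_Main "HOL-Number_Theory.Cong"
begin

(* Positions at or above v contribute nothing, since v < 2 ^ v;
   wt_binary_expansion shows that every binary expansion gives this value. *)
definition wt :: "nat \<Rightarrow> nat" where
  "wt v = (\<Sum>i<v. of_bool (bit v i))"

lemma wt_eq_card: "wt v = card {i. bit v i}"
proof -
  have "i < v" if "bit v i" for i
  proof (rule ccontr)
    assume "\<not> i < v"
    then have "v < 2 ^ i"
      by (meson less_exp not_less order_le_less_trans)
    with that show False
      by (simp add: bit_iff_odd)
  qed
  then have "{i. bit v i} = {i \<in> {..<v}. bit v i}"
    by auto
  then show ?thesis
    by (simp add: wt_def Int_def)
qed

lemma wt_binary_expansion:
  fixes b :: "nat \<Rightarrow> nat"
  assumes "\<And>i. i \<le> l \<Longrightarrow> b i \<in> {0, 1}"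
  shows "wt (\<Sum>i\<le>l. b i * 2 ^ i) = (\<Sum>i\<le>l. b i)"
proof -
  have b: "b i = of_bool (b i = 1)" if "i \<le> l" for i
    using assms[OF that] by auto
  have "(\<Sum>i\<le>l. b i * 2 ^ i) = horner_sum of_bool 2 (map (\<lambda>i. b i = 1) [0..<Suc l])"
    unfolding horner_sum_eq_sum
    by (rule sum.cong) (use b in \<open>auto simp: less_Suc_eq_le simp del: upt_Suc\<close>)
  then have "bit (\<Sum>i\<le>l. b i * 2 ^ i) n \<longleftrightarrow> n \<le> l \<and> b n = 1" for n
    by (auto simp: bit_horner_sum_bit_iff less_Suc_eq_le simp del: upt_Suc)
  then have "wt (\<Sum>i\<le>l. b i * 2 ^ i) = card {n \<in> {..l}. b n = 1}"
    by (simp add: wt_eq_card)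
  also have "\<dots> = (\<Sum>i\<le>l. of_bool (b i = 1))"
    by (simp add: Int_def)
  also have "\<dots> = (\<Sum>i\<le>l. b i)"
    by (rule sum.cong) (use b in auto)
  finally show ?thesis .
qed

definition is_least_pos_inverse :: "int \<Rightarrow> int \<Rightarrow> nat \<Rightarrow> bool" where
  "is_least_pos_inverse M d t \<longleftrightarrow>
     0 < t \<and> [d * int t = 1] (mod M) \<and>
     (\<forall>s>0. [d * int s = 1] (mod M) \<longrightarrow> t \<le> s)"

end

theory Submission imports Defs "HOL-Library.Nat_Bijection" begin

text \<open>
  Write \<open>q = 2 ^ k\<close>, \<open>R = 1 + q + q\<^sup>2 + q\<^sup>3 + q\<^sup>4\<close> and \<open>A = (2 * q - 1) / 3\<close>, which for odd \<open>k\<close> is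
  the integer \<open>4\<^sup>0 + \<dots> + 4 ^ ((k - 1) div 2)\<close>. The claimed inverse satisfies \<open>2 * t = R * A - 1\<close>,
  while the number to invert is \<open>R - 2\<close> and the modulus is \<open>R * (q - 1)\<close>. Hence
  \<open>2 * (R - 2) * t - 2 = R * ((R - 2) * A - 1)\<close>, and modulo \<open>q - 1\<close> the second factor is
  \<open>3 * A - 1 = 2 * (q - 1)\<close>, that is \<open>0\<close>, because \<open>R\<close> is \<open>5\<close> there. The modulus is odd, so the
  factor \<open>2\<close> cancels (\<open>inverse_congruence\<close>). Since \<open>t\<close> is below the modulus, it is the least
  positive inverse (\<open>is_least_pos_inverse_if_less\<close>).

  Expanding \<open>R * A\<close> gives the double sum of powers of two. Its exponents \<open>i * k + 2 * j\<close> are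
  pairwise distinct, because \<open>2 * j < k\<close> makes \<open>i\<close> the quotient by \<open>k\<close> and \<open>2 * j\<close> the remainder.
  So \<open>2 * t + 1\<close> has weight \<open>5 * (k + 1) / 2\<close> (\<open>wt_sum_powers\<close>), and dropping its last bit, a
  one, gives the weight of \<open>t\<close>.
\<close>

text \<open>Finite sets of naturals are encoded by the numbers whose one bits they index; the weight of
  a code is therefore the size of the set.\<close>

lemma wt_sum_powers:
  assumes "finite E"
  shows "wt (\<Sum>e\<in>E. 2 ^ e) = card E"
proof -
  have "{i. bit (\<Sum>e\<in>E. 2 ^ e :: nat) i} = set_decode (set_encode E)"
    by (simp add: set_decode_def set_encode_def bit_iff_odd)
  then show ?thesis
    by (simp add: wt_eq_card set_encode_inverse[OF assms])
qed

lemma wt_double_plus_one: "wt (2 * t + 1) = Suc (wt t)"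
proof -
  have shift: "{i. bit (2 * t + 1) i} = insert 0 (Suc ` {i. bit t i})"
  proof (intro set_eqI)
    fix i
    show "i \<in> {i. bit (2 * t + 1) i} \<longleftrightarrow> i \<in> insert 0 (Suc ` {i. bit t i})"
      by (cases i) (auto simp: bit_Suc bit_0)
  qed
  have "finite {i. bit t i}"
    by (rule finite_subset[of _ "{..t}"])
       (auto simp: bit_iff_odd, metis div_less even_zero less_exp nat_le_linear order_le_less_trans)
  then show ?thesis
    unfolding wt_eq_card shift by (subst card_insert_disjoint) (auto simp: card_image)
qed

text \<open>Inverses are unique modulo \<open>M\<close>, so no other one lies in the range from \<open>1\<close> to \<open>M - 1\<close>.\<close>

lemma is_least_pos_inverse_if_less:
  assumes "0 < t" and "int t < M" and inv: "[d * int t = 1] (mod M)"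
  shows "is_least_pos_inverse M d t"
  unfolding is_least_pos_inverse_def
proof (intro conjI allI impI)
  fix s :: nat
  assume "0 < s" and s: "[d * int s = 1] (mod M)"
  have "[int s * (d * int t) = int s * 1] (mod M)"
    using inv by (rule cong_scalar_left)
  moreover have "[int t * (d * int s) = int t * 1] (mod M)"
    using s by (rule cong_scalar_left)
  ultimately have "[int s = int t] (mod M)"
    by (simp add: mult.left_commute mult.commute cong_def)
  then show "t \<le> s"
    using cong_less_imp_eq_int[of "int s" M "int t"] assms(2) by force
qed (use assms in auto)

lemma inverse_congruence:
  fixes q A t :: int
  assumes "even q" and A: "3 * A = 2 * q - 1"
    and t: "2 * t = (q ^ 4 + q ^ 3 + q ^ 2 + q + 1) * A - 1"
  shows "[(q ^ 4 + q ^ 3 + q ^ 2 + q - 1) * t = 1] (mod q ^ 5 - 1)"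
proof -
  let ?R = "q ^ 4 + q ^ 3 + q ^ 2 + q + 1"
  let ?d = "q ^ 4 + q ^ 3 + q ^ 2 + q - 1"
  have "2 * (?d * t - 1) = ?d * (2 * t) - 2"
    by (simp add: algebra_simps)
  also have "\<dots> = ?d * (?R * A - 1) - 2"
    unfolding t ..
  \<comment> \<open>The cubic is the quotient of \<open>?R - 5\<close> by \<open>q - 1\<close>.\<close>
  also have "\<dots> = ?R * ((q - 1) * (q ^ 3 + 2 * q ^ 2 + 3 * q + 4) * A + (3 * A - 1))"
    by (simp add: algebra_simps power_numeral_reduce)
  also have "\<dots> = (q ^ 5 - 1) * ((q ^ 3 + 2 * q ^ 2 + 3 * q + 4) * A + 2)"
    unfolding A by (simp add: algebra_simps power_numeral_reduce)
  finally have "q ^ 5 - 1 dvd 2 * (?d * t - 1)"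
    by (metis dvd_triv_left)
  moreover have "coprime (q ^ 5 - 1) 2"
    using \<open>even q\<close> by simp
  ultimately show ?thesis
    unfolding cong_iff_dvd_diff by (simp only: coprime_dvd_mult_right_iff)
qed

theorem theorem2p1:
  fixes k :: nat
  assumes "k \<ge> 1" and "odd k"
  shows "\<exists>t :: nat.
    is_least_pos_inverse (2 ^ (5 * k) - 1)
      (2 ^ (4 * k) + 2 ^ (3 * k) + 2 ^ (2 * k) + 2 ^ k - 1) t \<and>
    real t = 1 / 2 * ((2 ^ (5 * k) - 1) / (2 ^ k - 1) * ((2 ^ (k + 1) - 1) / 3) - 1) \<and>
    2 * int t = (\<Sum>i = 0..4. \<Sum>j = 0..(k - 1) div 2. 2 ^ (i * k + 2 * j)) - 1 \<and>
    real (wt t) = (5 * real k + 3) / 2"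
proof -
  obtain h where k: "k = 2 * h + 1"
    using \<open>odd k\<close> by (auto elim: oddE)
  define q A R S :: nat where "q = 2 ^ k" and "A = (\<Sum>j = 0..h. 4 ^ j)"
    and "R = q ^ 4 + q ^ 3 + q ^ 2 + q + 1"
    and "S = (\<Sum>i = 0..4. \<Sum>j = 0..h. 2 ^ (i * k + 2 * j))"
  have q: "even q" "2 \<le> q"
    using self_le_power[of "2 :: nat" k] \<open>k \<ge> 1\<close> by (auto simp: q_def)
  have "3 * A + 1 = 4 ^ (h + 1)"
    unfolding A_def by (induction h) auto
  also have "(4 :: nat) ^ (h + 1) = 2 * q"
    by (simp add: q_def k power_mult)
  finally have A: "3 * A + 1 = 2 * q" .
  have "S = (\<Sum>i = 0..4. q ^ i) * A"
    by (simp add: S_def A_def q_def sum_product power_add power_mult mult.commute[of _ k])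
  also have "(\<Sum>i = 0..4. q ^ i) = R"
    by (simp add: R_def numeral_eq_Suc)
  finally have S: "S = R * A" .
  have "odd A"
    using A by presburger
  moreover have "odd R"
    using q by (simp add: R_def)
  ultimately have "odd S"
    by (simp add: S)
  then obtain t where t: "S = 2 * t + 1"
    by (rule oddE)
  have tint: "2 * int t = (int q ^ 4 + int q ^ 3 + int q ^ 2 + int q + 1) * int A - 1"
    using arg_cong[OF t[unfolded S R_def], of int] by (simp add: algebra_simps)
  have inv: "[(int q ^ 4 + int q ^ 3 + int q ^ 2 + int q - 1) * int t = 1] (mod int q ^ 5 - 1)"
    using inverse_congruence[OF _ _ tint] q A by simp

  have M: "int R * (int q - 1) = int q ^ 5 - 1"
    by (simp add: R_def algebra_simps power_numeral_reduce)
  \<comment> \<open>\<open>2 \<le> q\<close> gives \<open>2 * q - 1 \<le> 3 * (q - 1)\<close>, that is \<open>A \<le> q - 1\<close>.\<close>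
  have "int S \<le> int R * (int q - 1)"
    unfolding S of_nat_mult using A q by (intro mult_left_mono) auto
  then have less: "int t < int q ^ 5 - 1"
    unfolding M t by simp
  have "2 < R" "1 \<le> A"
    using q A by (auto simp: R_def)
  then have "2 < S"
    unfolding S by (metis less_le_trans mult.right_neutral mult_le_mono2)
  then have "0 < t"
    by (simp add: t)
  have least: "is_least_pos_inverse (2 ^ (5 * k) - 1)
      (2 ^ (4 * k) + 2 ^ (3 * k) + 2 ^ (2 * k) + 2 ^ k - 1) t"
    using is_least_pos_inverse_if_less[OF \<open>0 < t\<close> less inv]
    by (simp add: q_def power_mult[symmetric] mult.commute)

  have "real q ^ 5 - 1 = real R * (real q - 1)"
    by (simp add: R_def algebra_simps power_numeral_reduce)
  then have "(real q ^ 5 - 1) / (real q - 1) = real R"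
    using q by (simp add: field_simps)
  moreover have "(2 * real q - 1) / 3 = real A"
    using arg_cong[OF A, of real] by simp
  moreover have "real R * real A = 2 * real t + 1"
    using arg_cong[OF t[unfolded S], of real] by simp
  ultimately have "real t = 1 / 2 * ((real q ^ 5 - 1) / (real q - 1) * ((2 * real q - 1) / 3) - 1)"
    by simp
  then have closed:
      "real t = 1 / 2 * ((2 ^ (5 * k) - 1) / (2 ^ k - 1) * ((2 ^ (k + 1) - 1) / 3) - 1)"
    by (simp add: q_def power_mult[symmetric] mult.commute)

  have "int S = (\<Sum>i = 0..4. \<Sum>j = 0..(k - 1) div 2. 2 ^ (i * k + 2 * j))"
    by (simp add: S_def k)
  then have expansion: "2 * int t = (\<Sum>i = 0..4. \<Sum>j = 0..(k - 1) div 2. 2 ^ (i * k + 2 * j)) - 1"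
    by (simp add: t)

  define e where "e = (\<lambda>(i, j). i * k + 2 * j)"
  let ?I = "{0..4} \<times> {0..h} :: (nat \<times> nat) set"
  have inj: "inj_on e ?I"
  proof (rule inj_on_inverseI)
    fix p assume "p \<in> ?I"
    then have "2 * snd p < k"
      by (auto simp: k)
    then show "(\<lambda>n. (n div k, n mod k div 2)) (e p) = p"
      by (cases p) (simp add: e_def)
  qed
  have "S = (\<Sum>n \<in> e ` ?I. 2 ^ n)"
    by (subst sum.reindex[OF inj]) (simp add: S_def sum.cartesian_product e_def case_prod_unfold)
  then have "wt S = card ?I"
    using wt_sum_powers[of "e ` ?I"] by (simp add: card_image[OF inj])
  then have "Suc (wt t) = 5 * (h + 1)"
    unfolding t wt_double_plus_one by simp
  then have "real (wt t) = (5 * real k + 3) / 2"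
    by (simp add: k field_simps)
  with least closed expansion show ?thesis
    by blast
qed

end
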